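(* Let $g:[0,\infty)\to\mathbb{R}$ be monotonic nondecreasing. Then $$\delta_g(Q,P)\ \ge\ \left|\delta_{|g|}(Q,P)\right|\ \ge\ 0$$ for any $P,Q\in\mathcal{P}$.
   Context: $(X,\mathcal{A})$ is a measurable space with $|\mathcal{A}|>2$ and $\mu$ is a $\sigma$-finite measure on it. $\mathcal{P}$ is the set of all probability measures on $(X,\mathcal{A})$ which are absolutely continuous with respect to $\mu$; for $P,Q\in\mathcal{P}$, $p=\frac{dP}{d\mu}$ and $q=\frac{dQ}{d\mu}$ denote the Radon-Nikodym derivatives. For a measurable function $h:[0,\infty)\to\mathbb{R}$, the $\delta$-divergence is $$\delta_h(Q,P)=\int_X [q(x)-p(x)]\, h\!\left[\frac{q(x)}{p(x)}\right]d\mu(x),$$ and $|g|$ denotes the function $t\mapsto|g(t)|$. *)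

theory Defs
  imports "HOL-Probability.Probability"
begin

definition ac_prob_measures :: "'a measure \<Rightarrow> 'a measure set" where
  "ac_prob_measures M =
     {P. prob_space P \<and> sets P = sets M \<and> absolutely_continuous M P}"

text \<open>
  Real-valued representative of the density of \<open>P\<close>; the derivative
  is finite almost everywhere for a probability measure \<open>P\<close>.
\<close>

definition rn_density :: "'a measure \<Rightarrow> 'a measure \<Rightarrow> 'a \<Rightarrow> real" where
  "rn_density M P x = enn2real (RN_deriv M P x)"

text \<open>
  Lebesgue integral of an extended-real function, with values in \<open>[-\<infinity>, \<infinity>]\<close>.
  It is left unspecified when the positive and the negative part both have
  infinite integral (in \<^typ>\<open>ereal\<close> one would otherwise get \<open>\<infinity> - \<infinity> = \<infinity>\<close>).
\<close>

definition ext_integral :: "'a measure \<Rightarrow> ('a \<Rightarrow> ereal) \<Rightarrow> ereal" where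
  "ext_integral M F =
     (let pos = (\<integral>\<^sup>+x. e2ennreal (F x) \<partial>M); neg = (\<integral>\<^sup>+x. e2ennreal (- F x) \<partial>M)
      in if pos = \<infinity> \<and> neg = \<infinity> then undefined else enn2ereal pos - enn2ereal neg)"

text \<open>
  The expression \<open>(q - p) * h (q / p)\<close> equals \<open>p * f (q / p)\<close> with
  \<open>f t = (t - 1) * h t\<close>. At \<open>p = 0\<close> it is read by the usual convention for
  such divergences, \<open>0 * f (q / 0) = q * lim (u * f (1 / u))\<close> as \<open>u\<close> decreases
  to \<open>0\<close>; here \<open>u * f (1 / u) = (1 - u) * h (1 / u)\<close>, so the limit is that of
  \<open>h\<close> at infinity (possibly infinite; \<open>0 * \<infinity> = 0\<close> in \<^typ>\<open>ereal\<close>).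
  Isabelle's \<open>q / 0 = 0\<close> would give the value \<open>q * h 0\<close> instead.
\<close>

definition delta_integrand :: "(real \<Rightarrow> real) \<Rightarrow> real \<Rightarrow> real \<Rightarrow> ereal" where
  "delta_integrand h q p =
     (if p = 0 then ereal q * Lim at_top (\<lambda>t. ereal (h t))
      else ereal ((q - p) * h (q / p)))"

text \<open>Only the values of \<open>h\<close> on \<open>[0, \<infinity>)\<close> matter.\<close>

definition delta_divergence ::
    "'a measure \<Rightarrow> (real \<Rightarrow> real) \<Rightarrow> 'a measure \<Rightarrow> 'a measure \<Rightarrow> ereal" where
  "delta_divergence M h Q P =
     ext_integral M (\<lambda>x. delta_integrand h (rn_density M Q x) (rn_density M P x))"

end

theory Submission
  imports Defs
begin

text \<open>
  As \<open>P\<close> and \<open>Q\<close> have the same mass, the constant \<open>h 1\<close> may be subtracted from \<open>h\<close> without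
  changing \<open>\<delta>\<^sub>h\<close>. By monotonicity \<open>(q - p) * (g (q / p) - g 1)\<close> is nonnegative, and by the
  reverse triangle inequality it dominates the absolute value of
  \<open>(q - p) * (\<bar>g (q / p)\<bar> - \<bar>g 1\<bar>)\<close>. The integral of \<open>g\<close> thus always exists in
  \<open>(-\<infinity>, \<infinity>]\<close>; where it is infinite there is nothing to prove, and where it is finite both
  integrals are ordinary Lebesgue integrals.
\<close>

text \<open>This evaluates the \<open>Lim\<close> in the branch \<open>p = 0\<close> of
  \<open>delta_integrand\<close>. The supremum may be infinite, but it is at least
  \<open>g 1\<close>, which gives the comparisons with \<open>g 1\<close> in that branch.\<close>

lemma mono_on_tendsto_SUP_ereal:
  fixes g :: "real \<Rightarrow> real"
  assumes "mono_on {0..} g"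
  shows "((\<lambda>t. ereal (g t)) \<longlongrightarrow> (SUP t\<in>{0..}. ereal (g t))) at_top"
proof (rule order_tendstoI)
  fix a assume "a < (SUP t\<in>{0..}. ereal (g t))"
  then obtain s where "s \<ge> 0" "a < ereal (g s)"
    by (auto simp: less_SUP_iff)
  then have "a < ereal (g t)" if "t \<ge> s" for t
    using mono_onD[OF assms, of s t] that by (auto intro: less_le_trans)
  then show "eventually (\<lambda>t. a < ereal (g t)) at_top"
    by (auto simp: eventually_at_top_linorder)
next
  fix a assume a: "(SUP t\<in>{0..}. ereal (g t)) < a"
  have "ereal (g t) < a" if "t \<ge> 0" for t
    by (rule le_less_trans[OF SUP_upper a]) (use that in auto)
  then show "eventually (\<lambda>t. ereal (g t) < a) at_top"
    by (auto simp: eventually_at_top_linorder)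
qed

text \<open>Both factors change sign together, because \<open>q / p\<close> passes 1 exactly where
  \<open>q\<close> passes \<open>p\<close>.\<close>

lemma mult_diff_mono_on_nonneg:
  fixes g :: "real \<Rightarrow> real"
  assumes "mono_on {0..} g" "p > 0" "q \<ge> 0"
  shows "(q - p) * (g (q / p) - g 1) \<ge> 0"
proof (cases "q \<ge> p")
  case True
  then show ?thesis
    using mono_onD[OF assms(1), of 1 "q / p"] assms(2) by (intro mult_nonneg_nonneg) auto
next
  case False
  then show ?thesis
    using mono_onD[OF assms(1), of "q / p" 1] assms(2,3)
    by (intro mult_nonpos_nonpos) (auto simp: divide_le_eq)
qed

text \<open>For densities \<open>p\<close> and \<open>q\<close> of probability measures the lower
  bound is integrable, so the negative part of the integrand has finite integral.\<close>

lemma delta_integrand_mono_on_ge: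
  fixes g :: "real \<Rightarrow> real"
  assumes "mono_on {0..} g" "p \<ge> 0" "q \<ge> 0"
  shows "ereal ((q - p) * g 1) \<le> delta_integrand g q p"
proof (cases "p = 0")
  case True
  have "ereal (g 1) \<le> (SUP t\<in>{0..}. ereal (g t))"
    by (rule SUP_upper) auto
  then have "ereal q * ereal (g 1) \<le> ereal q * (SUP t\<in>{0..}. ereal (g t))"
    using assms(3) by (intro ereal_mult_left_mono) auto
  then show ?thesis
    using True tendsto_Lim[OF _ mono_on_tendsto_SUP_ereal[OF assms(1)]]
    by (simp add: delta_integrand_def)
next
  case False
  then show ?thesis
    using mult_diff_mono_on_nonneg[OF assms(1), of p q] assms(2,3)
    by (auto simp: delta_integrand_def algebra_simps)
qed

lemma delta_integrand_abs_bound: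
  fixes g :: "real \<Rightarrow> real"
  assumes mono: "mono_on {0..} g" and "p \<ge> 0" "q \<ge> 0"
    and fin: "delta_integrand g q p = ereal f"
  obtains f' where "delta_integrand (\<lambda>t. \<bar>g t\<bar>) q p = ereal f'"
    and "\<bar>f' - (q - p) * \<bar>g 1\<bar>\<bar> \<le> f - (q - p) * g 1"
proof (cases "p = 0")
  case False
  have "\<bar>(q - p) * \<bar>g (q / p)\<bar> - (q - p) * \<bar>g 1\<bar>\<bar> = \<bar>q - p\<bar> * \<bar>\<bar>g (q / p)\<bar> - \<bar>g 1\<bar>\<bar>"
    by (simp add: abs_mult flip: right_diff_distrib)
  also have "\<dots> \<le> \<bar>q - p\<bar> * \<bar>g (q / p) - g 1\<bar>"
    by (intro mult_left_mono) auto
  also have "\<dots> = (q - p) * (g (q / p) - g 1)"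
    using mult_diff_mono_on_nonneg[OF mono, of p q] False assms(2,3)
    by (simp flip: abs_mult)
  finally show ?thesis
    using that[of "(q - p) * \<bar>g (q / p)\<bar>"] fin False
    by (simp add: delta_integrand_def right_diff_distrib)
next
  case p: True
  show ?thesis
  proof (cases "q = 0")
    \<comment> \<open>Here the limit of \<open>g\<close> may be infinite without contradicting
      \<open>fin\<close>, since \<open>0 * \<infinity> = 0\<close>; both integrands vanish whatever
      the limits are.\<close>
    case True
    then show ?thesis
      using that[of 0] p fin by (simp add: delta_integrand_def zero_ereal_def[symmetric])
  next
    case False
    define L where "L = (SUP t\<in>{0..}. ereal (g t))"
    have lim: "((\<lambda>t. ereal (g t)) \<longlongrightarrow> L) at_top"
      unfolding L_def by (rule mono_on_tendsto_SUP_ereal[OF mono])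
    then have "ereal q * L = ereal f"
      using fin p tendsto_Lim[OF _ lim] by (simp add: delta_integrand_def)
    \<comment> \<open>As \<open>q\<close> is nonzero, an infinite \<open>L\<close> would make the
      product infinite. So \<open>L\<close> is real, and the limit can be taken inside the absolute
      value.\<close>
    then obtain l where l: "L = ereal l" "f = q * l"
      using False by (cases L) (auto split: if_splits)
    have "((\<lambda>t. \<bar>g t\<bar>) \<longlongrightarrow> \<bar>l\<bar>) at_top"
      using lim unfolding l(1) by (intro tendsto_rabs) simp
    then have "Lim at_top (\<lambda>t. ereal \<bar>g t\<bar>) = ereal \<bar>l\<bar>"
      by (intro tendsto_Lim) simp_all
    then have eq: "delta_integrand (\<lambda>t. \<bar>g t\<bar>) q p = ereal (q * \<bar>l\<bar>)"
      using p by (simp add: delta_integrand_def)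
    have "ereal (g 1) \<le> L"
      unfolding L_def by (rule SUP_upper) auto
    then have "\<bar>\<bar>l\<bar> - \<bar>g 1\<bar>\<bar> \<le> l - g 1"
      using l(1) by auto
    then have "q * \<bar>\<bar>l\<bar> - \<bar>g 1\<bar>\<bar> \<le> q * (l - g 1)"
      using assms(3) by (rule mult_left_mono)
    moreover have "\<bar>q * \<bar>l\<bar> - q * \<bar>g 1\<bar>\<bar> = q * \<bar>\<bar>l\<bar> - \<bar>g 1\<bar>\<bar>"
      using assms(3) by (simp add: abs_mult flip: right_diff_distrib)
    ultimately show ?thesis
      using that[OF eq] p l(2) by (simp add: right_diff_distrib)
  qed
qed

text \<open>Nothing is known of \<open>g\<close> on the negative reals; composing with
  \<open>max 0\<close> gives a function that is monotone on the whole line.\<close>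

lemma borel_measurable_mono_on_max:
  fixes g :: "real \<Rightarrow> real"
  assumes "mono_on {0..} g"
  shows "(\<lambda>t. g (max 0 t)) \<in> borel_measurable borel"
  by (rule borel_measurable_mono) (auto intro!: monoI mono_onD[OF assms])

text \<open>The \<open>max\<close> is harmless since \<open>q x / p x\<close> is never negative, and
  the \<open>Lim\<close> is a constant independent of \<open>x\<close>, so its existence does not
  matter here.\<close>

lemma borel_measurable_delta_integrand:
  fixes h :: "real \<Rightarrow> real"
  assumes h: "(\<lambda>t. h (max 0 t)) \<in> borel_measurable borel"
    and [measurable]: "q \<in> borel_measurable M" "p \<in> borel_measurable M"
    and nonneg: "\<And>x. q x \<ge> 0" "\<And>x. p x \<ge> 0"
  shows "(\<lambda>x. delta_integrand h (q x) (p x)) \<in> borel_measurable M"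
proof -
  have [measurable]: "(\<lambda>x. h (max 0 (q x / p x))) \<in> borel_measurable M"
    by (rule measurable_compose[OF _ h]) measurable
  have "(\<lambda>x. delta_integrand h (q x) (p x)) =
      (\<lambda>x. if p x = 0 then ereal (q x) * Lim at_top (\<lambda>t. ereal (h t))
           else ereal ((q x - p x) * h (max 0 (q x / p x))))"
    by (auto simp: delta_integrand_def nonneg max_absorb2 fun_eq_iff)
  then show ?thesis
    by simp
qed

lemma rn_density_nonneg: "rn_density M P x \<ge> 0"
  by (simp add: rn_density_def)

lemma borel_measurable_rn_density [measurable]: "rn_density M P \<in> borel_measurable M"
  unfolding rn_density_def[abs_def] by measurable

text \<open>The derivative has total integral 1, hence is finite almost everywhere, and
  \<open>enn2real\<close> changes it only on a null set.\<close>

lemma rn_density_integral: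
  assumes "sigma_finite_measure M" "P \<in> ac_prob_measures M"
  shows "integrable M (rn_density M P)" "integral\<^sup>L M (rn_density M P) = 1"
proof -
  interpret M: sigma_finite_measure M by fact
  interpret P: prob_space P
    using assms(2) by (simp add: ac_prob_measures_def)
  have "density M (RN_deriv M P) = P"
    using assms(2) by (intro M.density_RN_deriv) (auto simp: ac_prob_measures_def)
  then have one: "(\<integral>\<^sup>+x. RN_deriv M P x \<partial>M) = 1"
    using P.emeasure_space_1 nn_integral_density[of "RN_deriv M P" M "\<lambda>_. 1"] by simp
  then have "AE x in M. RN_deriv M P x \<noteq> \<infinity>"
    by (intro nn_integral_PInf_AE) auto
  then have "(\<integral>\<^sup>+x. ennreal (rn_density M P x) \<partial>M) = (\<integral>\<^sup>+x. RN_deriv M P x \<partial>M)"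
    by (intro nn_integral_cong_AE) (auto simp: rn_density_def less_top)
  then have "(\<integral>\<^sup>+x. ennreal (rn_density M P x) \<partial>M) = ennreal 1"
    using one by simp
  then have "integrable M (rn_density M P) \<and> integral\<^sup>L M (rn_density M P) = 1"
    by (subst (asm) nn_integral_eq_integrable) (auto simp: rn_density_nonneg)
  then show "integrable M (rn_density M P)" "integral\<^sup>L M (rn_density M P) = 1"
    by auto
qed

lemma ext_integral_eq_integral:
  assumes f: "integrable M f" and eq: "AE x in M. F x = ereal (f x)"
  shows "ext_integral M F = ereal (integral\<^sup>L M f)"
proof -
  have pos: "(\<integral>\<^sup>+x. e2ennreal (F x) \<partial>M) = (\<integral>\<^sup>+x. ennreal (f x) \<partial>M)"
    using eq by (intro nn_integral_cong_AE) (auto simp: ennreal.abs_eq)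
  have neg: "(\<integral>\<^sup>+x. e2ennreal (- F x) \<partial>M) = (\<integral>\<^sup>+x. ennreal (- f x) \<partial>M)"
    using eq by (intro nn_integral_cong_AE) (auto simp: ennreal.abs_eq)
  obtain a b where "(\<integral>\<^sup>+x. ennreal (f x) \<partial>M) = ennreal a" "a \<ge> 0"
    "(\<integral>\<^sup>+x. ennreal (- f x) \<partial>M) = ennreal b" "b \<ge> 0"
    using f unfolding real_integrable_def by (metis ennreal_cases infinity_ennreal_def)
  then show ?thesis
    by (simp add: ext_integral_def Let_def pos neg real_lebesgue_integral_def[OF f])
qed

text \<open>The minorant makes the negative part finite, so the unspecified case of
  \<open>ext_integral\<close> cannot occur; the positive part decides between the two
  alternatives.\<close>

lemma ext_integral_bounded_below:
  assumes [measurable]: "F \<in> borel_measurable M" and c: "integrable M c"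
    and ge: "\<And>x. ereal (c x) \<le> F x"
  obtains "ext_integral M F = \<infinity>"
  | f where "integrable M f" "AE x in M. F x = ereal (f x)"
proof -
  have neg: "(\<integral>\<^sup>+x. e2ennreal (- F x) \<partial>M) < \<infinity>"
  proof (rule le_less_trans)
    have "e2ennreal (- F x) \<le> ennreal (- c x)" for x
    proof -
      have "- F x \<le> ereal (- c x)"
        using ge[of x] by (cases "F x") auto
      then have "e2ennreal (- F x) \<le> e2ennreal (ereal (- c x))"
        by (rule e2ennreal_mono)
      then show ?thesis
        by (simp add: ennreal.abs_eq)
    qed
    then show "(\<integral>\<^sup>+x. e2ennreal (- F x) \<partial>M) \<le> (\<integral>\<^sup>+x. ennreal (- c x) \<partial>M)"
      by (intro nn_integral_mono)
    show "(\<integral>\<^sup>+x. ennreal (- c x) \<partial>M) < \<infinity>"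
      using c by (simp add: real_integrable_def less_top)
  qed
  show ?thesis
  proof (cases "(\<integral>\<^sup>+x. e2ennreal (F x) \<partial>M) = \<infinity>")
    case True
    then have "ext_integral M F = \<infinity>"
      using neg by (cases "\<integral>\<^sup>+x. e2ennreal (- F x) \<partial>M") (auto simp: ext_integral_def Let_def)
    then show ?thesis
      by (rule that(1))
  next
    case False
    define f where "f x = real_of_ereal (F x)" for x
    have [measurable]: "f \<in> borel_measurable M"
      unfolding f_def[abs_def] by measurable
    have "AE x in M. e2ennreal (F x) \<noteq> \<infinity>"
      using False by (intro nn_integral_PInf_AE) auto
    \<comment> \<open>The value \<open>-\<infinity>\<close> is ruled out by
      \<open>ge\<close>.\<close>
    moreover have "F x = ereal (f x)" if "e2ennreal (F x) \<noteq> \<infinity>" for x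
      using ge[of x] that by (cases "F x") (auto simp: f_def)
    ultimately have eq: "AE x in M. F x = ereal (f x)"
      by (auto elim!: eventually_mono)
    have "(\<integral>\<^sup>+x. ennreal (f x) \<partial>M) = (\<integral>\<^sup>+x. e2ennreal (F x) \<partial>M)"
      using eq by (intro nn_integral_cong_AE) (auto simp: ennreal.abs_eq)
    moreover have "(\<integral>\<^sup>+x. ennreal (- f x) \<partial>M) = (\<integral>\<^sup>+x. e2ennreal (- F x) \<partial>M)"
      using eq by (intro nn_integral_cong_AE) (auto simp: ennreal.abs_eq)
    ultimately have "integrable M f"
      using False neg by (simp add: real_integrable_def)
    then show ?thesis
      using eq by (rule that(2))
  qed
qed

theorem theorem8:
  fixes M :: "'a measure" and g :: "real \<Rightarrow> real" and P Q :: "'a measure"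
  assumes "sigma_finite_measure M"
    and "finite (sets M) \<longrightarrow> card (sets M) > 2"
    and "mono_on {0..} g"
    and "P \<in> ac_prob_measures M" and "Q \<in> ac_prob_measures M"
  shows "delta_divergence M g Q P \<ge> \<bar>delta_divergence M (\<lambda>t. \<bar>g t\<bar>) Q P\<bar>
       \<and> \<bar>delta_divergence M (\<lambda>t. \<bar>g t\<bar>) Q P\<bar> \<ge> 0"
proof -
  let ?p = "rn_density M P" and ?q = "rn_density M Q"
  define c where "c r x = (?q x - ?p x) * r" for r x
  note int = rn_density_integral[OF assms(1,4)] rn_density_integral[OF assms(1,5)]
  \<comment> \<open>Both densities integrate to 1, so the correction terms cancel.\<close>
  have c: "integrable M (c r)" "integral\<^sup>L M (c r) = 0" for r
    using int by (auto simp: c_def[abs_def])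
  let ?F = "\<lambda>x. delta_integrand g (?q x) (?p x)"
  let ?G = "\<lambda>x. delta_integrand (\<lambda>t. \<bar>g t\<bar>) (?q x) (?p x)"
  note meas = borel_measurable_mono_on_max[OF assms(3)]
  have F: "?F \<in> borel_measurable M"
    by (intro borel_measurable_delta_integrand meas) (auto simp: rn_density_nonneg)
  have G: "?G \<in> borel_measurable M"
    by (intro borel_measurable_delta_integrand borel_measurable_abs meas)
      (auto simp: rn_density_nonneg)
  have "ereal (c (g 1) x) \<le> ?F x" for x
    unfolding c_def by (intro delta_integrand_mono_on_ge assms(3) rn_density_nonneg)
  \<comment> \<open>If the right side is \<open>\<infinity>\<close>, the bound holds even should the
    integral of \<open>?G\<close> be unspecified; the closing \<open>simp\<close> settles that
    alternative.\<close>
  from F c(1) this have "\<bar>ext_integral M ?G\<bar> \<le> ext_integral M ?F"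
  proof (rule ext_integral_bounded_below)
    fix f assume f: "integrable M f" and eq: "AE x in M. ?F x = ereal (f x)"
    define f' where "f' x = real_of_ereal (?G x)" for x
    have [measurable]: "f' \<in> borel_measurable M"
      unfolding f'_def[abs_def] using G by measurable
    have "?G x = ereal (f' x) \<and> \<bar>f' x - c \<bar>g 1\<bar> x\<bar> \<le> f x - c (g 1) x"
      if "?F x = ereal (f x)" for x
      using delta_integrand_abs_bound[OF assms(3) rn_density_nonneg rn_density_nonneg that]
      unfolding c_def f'_def by (metis real_of_ereal.simps(1))
    with eq have G_eq: "AE x in M. ?G x = ereal (f' x)"
      and bound: "AE x in M. \<bar>f' x - c \<bar>g 1\<bar> x\<bar> \<le> f x - c (g 1) x"
      by (auto elim!: eventually_mono)
    \<comment> \<open>Integrability of \<open>f'\<close> is not known in advance; it comes from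
      domination by \<open>f - c (g 1)\<close> after the shift.\<close>
    have diff: "integrable M (\<lambda>x. f' x - c \<bar>g 1\<bar> x)"
      by (rule Bochner_Integration.integrable_bound[OF Bochner_Integration.integrable_diff[OF f c(1)[of "g 1"]]])
        (use bound c(1) in \<open>auto elim!: eventually_mono\<close>)
    then have f': "integrable M f'"
      using Bochner_Integration.integrable_add[OF diff c(1)[of "\<bar>g 1\<bar>"]] by simp
    have "\<bar>integral\<^sup>L M f'\<bar> = \<bar>\<integral>x. f' x - c \<bar>g 1\<bar> x \<partial>M\<bar>"
      using f' c by simp
    also have "\<dots> \<le> (\<integral>x. \<bar>f' x - c \<bar>g 1\<bar> x\<bar> \<partial>M)"
      by (rule integral_abs_bound)
    also have "\<dots> \<le> (\<integral>x. f x - c (g 1) x \<partial>M)"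
      using diff f c(1) bound by (intro integral_mono_AE) auto
    also have "\<dots> = integral\<^sup>L M f"
      using f c by simp
    finally show ?thesis
      using ext_integral_eq_integral[OF f eq] ext_integral_eq_integral[OF f' G_eq] by simp
  qed simp
  then show ?thesis
    by (simp add: delta_divergence_def)
qed

end
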